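(* Let $N\ge2$ and let $\mathcal H=\{\mathbf v\in\mathbb R^{N-1}:\boldsymbol\alpha^\top(\mathbf v-\mathbf c)=0\}$ be a given hyperplane, $\boldsymbol\alpha\in\mathbb R^{N-1}\setminus\{0\}$, $\mathbf c\in\mathbb R^{N-1}$. Then there exists a pair of products $A,B$ with attribute vectors $\mathbf x^A,\mathbf x^B\in\mathbb R^N$ satisfying $$x^A_N-x^B_N=-\sum_{j=1}^{N-1}\alpha_jc_j,\qquad x^A_i-x^B_i=(x_N^A-x_N^B)+\alpha_i=-\sum_{j=1}^{N-1}\alpha_jc_j+\alpha_i,\quad i=1,\dots,N-1,$$ such that $\mathcal H$ is the separating hyperplane of the query $(A,B)$.
   Context: $R:\mathbb R^{N-1}\to\mathbb R^N$ is the recovery mapping $R\mathbf y=(\mathbf y,1-\mathbf e^\top\mathbf y)$, with $\mathbf e$ the all-ones vector. The hyperplane $\mathcal H$ is a separating hyperplane of the query $(A,B)$ if (i) $(R\mathbf v)^\top(\mathbf x^A-\mathbf x^B)=0$ for all $\mathbf v\in\mathcal H$; and (ii) $[(R\mathbf v^+)^\top(\mathbf x^A-\mathbf x^B)]\,[(R\mathbf v^-)^\top(\mathbf x^A-\mathbf x^B)]\le0$ for all $\mathbf v^+\in\mathcal H_+=\{\mathbf v:\boldsymbol\alpha^\top(\mathbf v-\mathbf c)\ge0\}$ and $\mathbf v^-\in\mathcal H_-=\{\mathbf v:\boldsymbol\alpha^\top(\mathbf v-\mathbf c)\le0\}$. *)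

theory Defs
  imports Complex_Main "Jordan_Normal_Form.Matrix"
begin

text \<open>
  \<open>\<real>\<^sup>n\<close> is \<open>carrier_vec n\<close>, with coordinates indexed from \<open>0\<close>: the \<open>j\<close>-th coordinate of the
  mathematical text is \<open>x $ (j - 1)\<close>, so the last coordinate of a vector of \<open>\<real>\<^sup>N\<close> is \<open>x $ (N - 1)\<close>.
  A product is identified with its attribute vector, and a query with a pair of such vectors.
\<close>

definition ones_vec :: "nat \<Rightarrow> real vec" where
  "ones_vec n = vec n (\<lambda>_. 1)"

definition recovery :: "real vec \<Rightarrow> real vec" where
  "recovery y = y @\<^sub>v vec 1 (\<lambda>_. 1 - ones_vec (dim_vec y) \<bullet> y)"

definition hyperplane :: "nat \<Rightarrow> real vec \<Rightarrow> real vec \<Rightarrow> real vec set" where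
  "hyperplane n \<alpha> c = {v \<in> carrier_vec n. \<alpha> \<bullet> (v - c) = 0}"

definition halfspace_pos :: "nat \<Rightarrow> real vec \<Rightarrow> real vec \<Rightarrow> real vec set" where
  "halfspace_pos n \<alpha> c = {v \<in> carrier_vec n. \<alpha> \<bullet> (v - c) \<ge> 0}"

definition halfspace_neg :: "nat \<Rightarrow> real vec \<Rightarrow> real vec \<Rightarrow> real vec set" where
  "halfspace_neg n \<alpha> c = {v \<in> carrier_vec n. \<alpha> \<bullet> (v - c) \<le> 0}"

text \<open>
  The hyperplane is passed through its data \<open>\<alpha>\<close>, \<open>c\<close>, since these determine which side is which;
  \<open>xA\<close> and \<open>xB\<close> are the attribute vectors of the query.
\<close>

definition separating_hyperplane ::
  "nat \<Rightarrow> real vec \<Rightarrow> real vec \<Rightarrow> real vec \<Rightarrow> real vec \<Rightarrow> bool" where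
  "separating_hyperplane N \<alpha> c xA xB \<longleftrightarrow>
     (\<forall>v \<in> hyperplane (N - 1) \<alpha> c. recovery v \<bullet> (xA - xB) = 0) \<and>
     (\<forall>vp \<in> halfspace_pos (N - 1) \<alpha> c. \<forall>vm \<in> halfspace_neg (N - 1) \<alpha> c.
        (recovery vp \<bullet> (xA - xB)) * (recovery vm \<bullet> (xA - xB)) \<le> 0)"

end

theory Submission imports Defs begin

text \<open>
  The prescribed differences satisfy \<open>recovery v \<bullet> (xA - xB) = \<alpha> \<bullet> (v - c)\<close> identically in \<open>v\<close>, which
  makes both separation conditions immediate. For uniqueness, if \<open>v \<mapsto> \<alpha> \<bullet> (v - c)\<close> vanishes on
  another hyperplane, orthogonal projection onto the latter shows that it is a scalar multiple of
  \<open>v \<mapsto> \<alpha>' \<bullet> (v - c')\<close>; the scalar is nonzero because \<open>\<alpha> \<noteq> 0\<close>, so the zero sets agree.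
\<close>

lemma scalar_prod_self_pos:
  fixes v :: "real vec"
  assumes "v \<in> carrier_vec n" and "v \<noteq> 0\<^sub>v n"
  shows "v \<bullet> v > 0"
proof -
  obtain i where i: "i < n" "v $ i \<noteq> 0"
    using assms by (metis carrier_vecD eq_vecI index_zero_vec)
  have "(\<Sum>j = 0..<n. v $ j * v $ j) > 0"
    using i by (intro sum_pos2[of _ i]) (auto simp: zero_less_mult_iff)
  then show ?thesis
    using assms(1) by (auto simp: scalar_prod_def)
qed

text \<open>Both sides are affine of dimension \<open>n - 1\<close>, so inclusion already forces
  equality.\<close>

lemma hyperplane_eqI_subset:
  assumes \<alpha>: "\<alpha> \<in> carrier_vec n" "\<alpha> \<noteq> 0\<^sub>v n" and c: "c \<in> carrier_vec n"
    and \<alpha>': "\<alpha>' \<in> carrier_vec n" "\<alpha>' \<noteq> 0\<^sub>v n" and c': "c' \<in> carrier_vec n"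
    and sub: "hyperplane n \<alpha>' c' \<subseteq> hyperplane n \<alpha> c"
  shows "hyperplane n \<alpha>' c' = hyperplane n \<alpha> c"
proof -
  \<comment> \<open>Pairing the expected relation \<alpha> = k \<alpha>' with \<alpha>' forces this
    value.\<close>
  define k where "k = (\<alpha> \<bullet> \<alpha>') / (\<alpha>' \<bullet> \<alpha>')"
  have pos: "\<alpha>' \<bullet> \<alpha>' > 0"
    using scalar_prod_self_pos \<alpha>' .
  have proportional: "\<alpha> \<bullet> (v - c) = k * (\<alpha>' \<bullet> (v - c'))" if v: "v \<in> carrier_vec n" for v
  proof -
    \<comment> \<open>With this \<open>t\<close>, \<open>p\<close> is the foot of the perpendicular
      from \<open>v\<close> to the primed hyperplane.\<close>
    define t where "t = (\<alpha>' \<bullet> (v - c')) / (\<alpha>' \<bullet> \<alpha>')"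
    define p where "p = v - t \<cdot>\<^sub>v \<alpha>'"
    have p: "p \<in> carrier_vec n"
      using v \<alpha>' by (simp add: p_def)
    have prod_p: "\<beta> \<bullet> (p - d) = \<beta> \<bullet> (v - d) - t * (\<beta> \<bullet> \<alpha>')"
      if "\<beta> \<in> carrier_vec n" "d \<in> carrier_vec n" for \<beta> d
      using that v \<alpha>' by (simp add: p_def scalar_prod_minus_distrib[of _ n])
    have "p \<in> hyperplane n \<alpha>' c'"
      using p pos prod_p[OF \<alpha>'(1) c'] by (simp add: hyperplane_def t_def)
    then have "\<alpha> \<bullet> (p - c) = 0"
      using sub by (auto simp: hyperplane_def)
    then show ?thesis
      using prod_p[OF \<alpha>(1) c] by (simp add: k_def t_def)
  qed
  \<comment> \<open>At \<open>v = c + \<alpha>\<close> the left side of \<open>proportional\<close>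
    is \<open>\<alpha> \<bullet> \<alpha> > 0\<close>, which excludes \<open>k = 0\<close>.\<close>
  have "(c + \<alpha>) - c = \<alpha>"
    using \<alpha> c by auto
  then have "k \<noteq> 0"
    using proportional[of "c + \<alpha>"] scalar_prod_self_pos[OF \<alpha>] \<alpha> c by auto
  then show ?thesis
    using proportional by (auto simp: hyperplane_def)
qed

text \<open>Since the last entry of \<open>recovery v\<close> is one minus the sum of the others,
  the product is affine in \<open>v\<close>, with gradient entries \<open>d $ i - d $ n\<close> and
  constant term \<open>d $ n\<close>.\<close>

lemma recovery_scalar_prod:
  assumes v: "v \<in> carrier_vec n" and d: "d \<in> carrier_vec (Suc n)"
  shows "recovery v \<bullet> d = (\<Sum>i<n. v $ i * (d $ i - d $ n)) + d $ n"
proof -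
  have "recovery v \<bullet> d = (\<Sum>i<n. v $ i * d $ i) + (1 - (\<Sum>i<n. v $ i)) * d $ n"
    using assms by (auto simp: scalar_prod_def recovery_def ones_vec_def atLeast0LessThan)
  then show ?thesis
    by (simp add: algebra_simps sum_subtractf sum_distrib_left)
qed

theorem theorem3p1:
  fixes N :: nat and \<alpha> c :: "real vec"
  assumes "N \<ge> 2"
    and "\<alpha> \<in> carrier_vec (N - 1)" and "\<alpha> \<noteq> 0\<^sub>v (N - 1)"
    and "c \<in> carrier_vec (N - 1)"
  shows "\<exists>xA \<in> carrier_vec N. \<exists>xB \<in> carrier_vec N.
           xA $ (N - 1) - xB $ (N - 1) = - (\<Sum>j<N - 1. \<alpha> $ j * c $ j) \<and>
           (\<forall>i<N - 1. xA $ i - xB $ i = (xA $ (N - 1) - xB $ (N - 1)) + \<alpha> $ i \<and>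
                      xA $ i - xB $ i = - (\<Sum>j<N - 1. \<alpha> $ j * c $ j) + \<alpha> $ i) \<and>
           separating_hyperplane N \<alpha> c xA xB \<and>
           (\<forall>\<alpha>' \<in> carrier_vec (N - 1). \<forall>c' \<in> carrier_vec (N - 1).
              \<alpha>' \<noteq> 0\<^sub>v (N - 1) \<and> separating_hyperplane N \<alpha>' c' xA xB \<longrightarrow>
              hyperplane (N - 1) \<alpha>' c' = hyperplane (N - 1) \<alpha> c)"
proof -
  define n where "n = N - 1"
  have N: "N = Suc n"
    using assms(1) by (simp add: n_def)
  have \<alpha>: "\<alpha> \<in> carrier_vec n" "\<alpha> \<noteq> 0\<^sub>v n" and c: "c \<in> carrier_vec n"
    using assms by (simp_all add: n_def)
  define s where "s = (\<Sum>j<n. \<alpha> $ j * c $ j)"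
  \<comment> \<open>Matching gradient and constant term with those of
    \<open>\<alpha> \<bullet> (v - c)\<close> gives \<open>d $ n = - s\<close> and
    \<open>d $ i - d $ n = \<alpha> $ i\<close>.\<close>
  define d where "d = vec (Suc n) (\<lambda>i. if i < n then - s + \<alpha> $ i else - s)"
  have d: "d \<in> carrier_vec (Suc n)"
    by (simp add: d_def)
  have recovery_d: "recovery v \<bullet> d = \<alpha> \<bullet> (v - c)" if v: "v \<in> carrier_vec n" for v
    using v c unfolding recovery_scalar_prod[OF v d]
    by (simp add: d_def s_def scalar_prod_def atLeast0LessThan algebra_simps sum_subtractf)
  \<comment> \<open>Only the difference of the products matters, so \<open>xA = d\<close> and
    \<open>xB = 0\<close> will do.\<close>
  have "d - 0\<^sub>v N = d"
    using d N by auto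
  have separating: "separating_hyperplane N \<alpha> c d (0\<^sub>v N)"
    unfolding separating_hyperplane_def \<open>d - 0\<^sub>v N = d\<close> n_def[symmetric]
    by (auto simp: hyperplane_def halfspace_pos_def halfspace_neg_def recovery_d
        mult_nonneg_nonpos)
  \<comment> \<open>By \<open>recovery_d\<close>, condition (i) for the other hyperplane says that
    it lies inside the given one.\<close>
  have unique: "hyperplane n \<alpha>' c' = hyperplane n \<alpha> c"
    if "\<alpha>' \<in> carrier_vec n" "c' \<in> carrier_vec n" "\<alpha>' \<noteq> 0\<^sub>v n"
      and sep: "separating_hyperplane N \<alpha>' c' d (0\<^sub>v N)" for \<alpha>' c'
  proof (rule hyperplane_eqI_subset)
    show "hyperplane n \<alpha>' c' \<subseteq> hyperplane n \<alpha> c"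
      using sep recovery_d
      unfolding separating_hyperplane_def \<open>d - 0\<^sub>v N = d\<close> n_def[symmetric]
      by (auto simp: hyperplane_def)
  qed (use that \<alpha> c in auto)
  show ?thesis
  proof (intro bexI conjI)
    show "d $ (N - 1) - 0\<^sub>v N $ (N - 1) = - (\<Sum>j<N - 1. \<alpha> $ j * c $ j)"
      by (simp add: N d_def s_def)
    show "\<forall>i<N - 1. d $ i - 0\<^sub>v N $ i = (d $ (N - 1) - 0\<^sub>v N $ (N - 1)) + \<alpha> $ i \<and>
                    d $ i - 0\<^sub>v N $ i = - (\<Sum>j<N - 1. \<alpha> $ j * c $ j) + \<alpha> $ i"
      by (simp add: N d_def s_def)
  qed (use d N separating unique in auto)
qed

end
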